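(* For any $\lambda\in[0,\infty)$ and $\phi\in(0,\infty)$, $$\inf_{M\in\mathbb N,\ \phi_s\in[\phi,\infty]}\mathscr R^{\mathrm{sub}}_{\lambda,M}(\phi,\phi_s)\ \le\ \inf_{M\in\mathbb N,\ \phi_s\in[\phi,\infty]}\mathscr R^{\mathrm{spl}}_{\lambda,M}(\phi,\phi_s),$$ i.e. optimal subagging is at least as good as optimal splagging (without replacement) in terms of limiting squared risk for ridge and ridgeless predictors.
   Context: Let $0<r_{\min}\le r_{\max}<\infty$, let $H,G$ be probability measures supported on $[r_{\min},r_{\max}]$ (limiting spectral distribution of the feature covariance and limiting signal-weighted spectral distribution), and let $\rho^2,\sigma^2\ge0$ be finite (signal energy, noise variance). For $\lambda>0,\theta\in(0,\infty)$, $v(-\lambda;\theta)$ is the unique nonnegative solution of $\frac1{v}=\lambda+\theta\int\frac{r}{1+vr}dH(r)$; $v(0;\theta)=\lim_{\lambda\to0^+}v(-\lambda;\theta)$ if $\theta>1$ and $+\infty$ if $\theta\in(0,1]$. With $v=v(-\lambda;\theta)$, $$\widetilde v(-\lambda;\vartheta,\theta)=\frac{\vartheta\int r^2(1+vr)^{-2}dH(r)}{v^{-2}-\vartheta\int r^2(1+vr)^{-2}dH(r)},\qquad \widetilde c(-\lambda;\theta)=\int\frac{r}{(1+vr)^2}dG(r).$$ At $\theta=\infty$: $v=0$, $\widetilde v=0$, $\widetilde c=\int r\,dG(r)$ (limits as $\theta\to\infty$). For $\vartheta\le\theta$, $B_\lambda(\vartheta,\theta)=\rho^2(1+\widetilde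 v(-\lambda;\vartheta,\theta))\widetilde c(-\lambda;\theta)$, $V_\lambda(\vartheta,\theta)=\sigma^2\widetilde v(-\lambda;\vartheta,\theta)$, $C_\lambda(\theta)=\rho^2\widetilde c(-\lambda;\theta)$; for $\lambda=0$ and $\theta\le1$ these are read as $B_0(\vartheta,\theta)=C_0(\theta)=0$ for $\theta\in(0,1]$, $V_0(\vartheta,\theta)=\sigma^2\vartheta/(1-\vartheta)$ for $\theta\in(0,1)$, and $V_0(\vartheta,1)=\infty$ (with value $0$ if $\sigma^2=0$). Limiting subagged risk: $\mathscr R^{\mathrm{sub}}_{\lambda,M}(\phi,\phi_s)=\sigma^2+M^{-1}\big(B_\lambda(\phi_s,\phi_s)+V_\lambda(\phi_s,\phi_s)\big)+(1-M^{-1})\big(B_\lambda(\phi,\phi_s)+V_\lambda(\phi,\phi_s)\big)$, $M\in\mathbb N$. Limiting splagged risk: $\mathscr R^{\mathrm{spl}}_{\lambda,M}(\phi,\phi_s)=\sigma^2+M^{-1}\big(B_\lambda(\phi_s,\phi_s)+V_\lambda(\phi_s,\phi_s)\big)+(1-M^{-1})C_\lambda(\phi_s)$ for $M\le\lfloor\phi_s/\phi\rfloor$, and equal to its value at $M=\lfloor\phi_s/\phi\rfloor$ for $M\ge\lfloor\phi_s/\phi\rfloor$. *)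

theory Defs
  imports "HOL-Probability.Probability"
begin

text \<open>
  Throughout, \<open>H\<close> is the limiting spectral distribution of the feature covariance, \<open>G\<close> the
  limiting signal-weighted spectral distribution, \<open>\<rho>\<^sup>2\<close> the signal energy, \<open>\<sigma>\<^sup>2\<close> the noise
  variance and \<open>l \<ge> 0\<close> the ridge penalty. In functions of two aspect ratios, the first one
  is written \<open>\<psi>\<close>, the second one \<open>\<theta>\<close>, and \<open>0 < \<psi> \<le> \<theta> \<le> \<infinity>\<close> is intended.
\<close>

definition supported_on :: "real measure \<Rightarrow> real set \<Rightarrow> bool" where
  "supported_on \<mu> S \<longleftrightarrow> prob_space \<mu> \<and> sets \<mu> = sets borel \<and> measure \<mu> S = 1"

text \<open>
  \<open>v(-l; \<theta>)\<close> for \<open>l > 0\<close> and finite \<open>\<theta> > 0\<close>. As \<open>1 / 0 = 0\<close> and the right-hand side is positive,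
  \<open>v = 0\<close> is never a solution.
\<close>

definition v_ridge :: "real measure \<Rightarrow> real \<Rightarrow> real \<Rightarrow> real" where
  "v_ridge H l \<theta> =
     (THE v. v \<ge> 0 \<and> 1 / v = l + \<theta> * (\<integral>r. r / (1 + v * r) \<partial>H))"

definition v_fun :: "real measure \<Rightarrow> real \<Rightarrow> ereal \<Rightarrow> ereal" where
  "v_fun H l \<theta> =
     (if \<theta> = \<infinity> then 0
      else if l > 0 then ereal (v_ridge H l (real_of_ereal \<theta>))
      else if \<theta> > 1 then ereal (Lim (at_right 0) (\<lambda>k. v_ridge H k (real_of_ereal \<theta>)))
      else \<infinity>)"

text \<open>
  The next two functions are only meaningful where \<open>v_fun\<close> is finite. The remaining case
  (\<open>l = 0\<close> and \<open>\<theta> \<le> 1\<close>) is covered by the separate clauses in \<open>B_lim\<close>, \<open>V_lim\<close> and \<open>C_lim\<close>.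
  For \<open>c_tilde\<close>, the value at \<open>\<theta> = \<infinity>\<close> is the formula at \<open>v = 0\<close>, i.e. the first moment of \<open>G\<close>.
\<close>

definition v_tilde :: "real measure \<Rightarrow> real \<Rightarrow> ereal \<Rightarrow> ereal \<Rightarrow> real" where
  "v_tilde H l \<psi> \<theta> =
     (if \<theta> = \<infinity> then 0
      else let v = real_of_ereal (v_fun H l \<theta>);
               a = real_of_ereal \<psi> * (\<integral>r. r\<^sup>2 / (1 + v * r)\<^sup>2 \<partial>H)
           in a / (1 / v\<^sup>2 - a))"

definition c_tilde :: "real measure \<Rightarrow> real measure \<Rightarrow> real \<Rightarrow> ereal \<Rightarrow> real" where
  "c_tilde H G l \<theta> =
     (let v = real_of_ereal (v_fun H l \<theta>) in \<integral>r. r / (1 + v * r)\<^sup>2 \<partial>G)"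

definition B_lim ::
    "real measure \<Rightarrow> real measure \<Rightarrow> real \<Rightarrow> real \<Rightarrow> ereal \<Rightarrow> ereal \<Rightarrow> real" where
  "B_lim H G \<rho> l \<psi> \<theta> =
     (if l = 0 \<and> \<theta> \<le> 1 then 0
      else \<rho>\<^sup>2 * (1 + v_tilde H l \<psi> \<theta>) * c_tilde H G l \<theta>)"

definition V_lim :: "real measure \<Rightarrow> real \<Rightarrow> real \<Rightarrow> ereal \<Rightarrow> ereal \<Rightarrow> ereal" where
  "V_lim H \<sigma> l \<psi> \<theta> =
     (if l = 0 \<and> \<theta> < 1 then
        ereal (\<sigma>\<^sup>2 * real_of_ereal \<psi> / (1 - real_of_ereal \<psi>))
      else if l = 0 \<and> \<theta> = 1 then (if \<sigma>\<^sup>2 = 0 then 0 else \<infinity>)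
      else ereal (\<sigma>\<^sup>2 * v_tilde H l \<psi> \<theta>))"

definition C_lim :: "real measure \<Rightarrow> real measure \<Rightarrow> real \<Rightarrow> real \<Rightarrow> ereal \<Rightarrow> real" where
  "C_lim H G \<rho> l \<theta> = (if l = 0 \<and> \<theta> \<le> 1 then 0 else \<rho>\<^sup>2 * c_tilde H G l \<theta>)"

definition risk_sub ::
    "real measure \<Rightarrow> real measure \<Rightarrow> real \<Rightarrow> real \<Rightarrow> real \<Rightarrow> nat \<Rightarrow> real \<Rightarrow> ereal \<Rightarrow> ereal" where
  "risk_sub H G \<rho> \<sigma> l M \<phi> \<phi>\<^sub>s =
     ereal (\<sigma>\<^sup>2)
     + ereal (1 / real M) * (ereal (B_lim H G \<rho> l \<phi>\<^sub>s \<phi>\<^sub>s) + V_lim H \<sigma> l \<phi>\<^sub>s \<phi>\<^sub>s)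
     + ereal (1 - 1 / real M) *
         (ereal (B_lim H G \<rho> l (ereal \<phi>) \<phi>\<^sub>s) + V_lim H \<sigma> l (ereal \<phi>) \<phi>\<^sub>s)"

text \<open>
  Sampling without replacement admits at most \<open>\<lfloor>\<phi>\<^sub>s / \<phi>\<rfloor>\<close> disjoint subsamples (no bound if
  \<open>\<phi>\<^sub>s = \<infinity>\<close>). Beyond this number the risk stays constant.
\<close>

definition capped :: "nat \<Rightarrow> real \<Rightarrow> ereal \<Rightarrow> nat" where
  "capped M \<phi> \<phi>\<^sub>s = (if \<phi>\<^sub>s = \<infinity> then M else min M (nat \<lfloor>real_of_ereal \<phi>\<^sub>s / \<phi>\<rfloor>))"

definition risk_spl ::
    "real measure \<Rightarrow> real measure \<Rightarrow> real \<Rightarrow> real \<Rightarrow> real \<Rightarrow> nat \<Rightarrow> real \<Rightarrow> ereal \<Rightarrow> ereal" where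
  "risk_spl H G \<rho> \<sigma> l M \<phi> \<phi>\<^sub>s =
     (let m = capped M \<phi> \<phi>\<^sub>s in
      ereal (\<sigma>\<^sup>2)
      + ereal (1 / real m) * (ereal (B_lim H G \<rho> l \<phi>\<^sub>s \<phi>\<^sub>s) + V_lim H \<sigma> l \<phi>\<^sub>s \<phi>\<^sub>s)
      + ereal (1 - 1 / real m) * ereal (C_lim H G \<rho> l \<phi>\<^sub>s))"

end

theory Submission imports Defs
begin

text \<open>
  The two infima are compared fibrewise: for a fixed subsample aspect ratio \<open>\<theta>\<close>, the splagged risk
  with any number \<open>M\<close> of bags is at least the limit of the subagged risk as \<open>M \<rightarrow> \<infinity>\<close>
  (lemma \<open>INF_risk_sub_le_risk_spl\<close>).

  With \<open>K(\<psi>) = \<psi> a / (d - \<psi> a)\<close>, \<open>d = v\<^sup>-\<^sup>2\<close> and \<open>a = \<integral> r\<^sup>2 (1 + v r)\<^sup>-\<^sup>2 dH\<close>, where \<open>v\<close> does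
  not depend on \<open>\<psi>\<close>, one has \<open>B(\<psi>, \<theta>) = c (1 + K(\<psi>))\<close>, \<open>V(\<psi>, \<theta>) = \<sigma>\<^sup>2 K(\<psi>)\<close> and \<open>C(\<theta>) = c\<close> for some
  \<open>c \<ge> 0\<close>. Hence the limiting subagged risk is \<open>\<sigma>\<^sup>2 + c + (c + \<sigma>\<^sup>2) K(\<phi>)\<close>, whereas the splagged
  risk with \<open>m \<le> \<theta> / \<phi>\<close> bags is \<open>\<sigma>\<^sup>2 + c + (c + \<sigma>\<^sup>2) K(\<theta>) / m\<close>. So everything reduces to
  \<open>m K(\<phi>) \<le> K(\<theta>)\<close> for \<open>m \<phi> \<le> \<theta>\<close>, which holds because \<open>K\<close> vanishes at \<open>0\<close> and is increasing
  and convex on \<open>[0, \<theta>]\<close> as long as it has no pole there, that is, as long as \<open>\<theta> a < d\<close>. The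
  boundary values of \<open>\<theta>\<close> have the same shape: \<open>K = 0\<close> for \<open>\<theta> = \<infinity>\<close>, and \<open>c = 0\<close>, \<open>a = d = 1\<close>
  for \<open>l = 0\<close>, \<open>\<theta> < 1\<close>; for \<open>l = 0\<close>, \<open>\<theta> = 1\<close> the splagged risk is infinite or both risks vanish.

  That \<open>K\<close> has no pole comes from the fixed-point equation of \<open>v\<close>. Multiplied by \<open>v\<close>, the
  equation reads \<open>l v + \<theta> \<integral> x dH = 1\<close> with \<open>x = v r / (1 + v r) < 1\<close>, while
  \<open>\<theta> a / d = \<theta> \<integral> x\<^sup>2 dH\<close>. This argument needs the equation for the limit \<open>v(0; \<theta>)\<close> as well, so the
  convergence of \<open>v(-k; \<theta>)\<close> to the root of the equation with \<open>l = 0\<close> is established too.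
\<close>

section \<open>The fixed-point equation\<close>

text \<open>
  The fixed-point equation multiplied by \<open>v\<close> becomes \<open>l v + \<theta> eff_df H v = 1\<close>, which has no
  singularity at \<open>v = 0\<close> and makes sense for \<open>l = 0\<close>. With \<open>\<kappa> = 1 / v\<close> the integral is the
  normalised effective degrees of freedom \<open>\<integral> r / (r + \<kappa>) dH\<close> of ridge regression.
\<close>

definition eff_df :: "real measure \<Rightarrow> real \<Rightarrow> real" where
  "eff_df H v = (\<integral>r. v * r / (1 + v * r) \<partial>H)"

locale compact_spectrum =
  fixes H :: "real measure" and a b :: real
  assumes a_pos: "0 < a" and a_le_b: "a \<le> b" and supported: "supported_on H {a..b}"
begin

sublocale prob_space H
  using supported by (simp add: supported_on_def)

lemma sets_eq [measurable_cong]: "sets H = sets borel"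
  using supported by (simp add: supported_on_def)

lemma AE_support: "AE r in H. a \<le> r \<and> r \<le> b"
proof -
  have "{a..b} \<in> events" by (simp add: sets_eq)
  moreover have "prob {a..b} = 1" using supported by (simp add: supported_on_def)
  ultimately have "AE r in H. r \<in> {a..b}" using prob_eq_1 by blast
  then show ?thesis by simp
qed

lemma integrable_bounded_on_support:
  fixes f :: "real \<Rightarrow> real"
  assumes "f \<in> borel_measurable borel" and "\<And>r. a \<le> r \<Longrightarrow> r \<le> b \<Longrightarrow> \<bar>f r\<bar> \<le> K"
  shows "integrable H f"
proof (rule integrable_const_bound[where B = K])
  show "f \<in> borel_measurable H" using assms(1) measurable_cong_sets[OF sets_eq refl] by blast
  show "AE r in H. norm (f r) \<le> K" using AE_support by eventually_elim (use assms(2) in auto)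
qed

lemma integral_nonneg_on_support:
  fixes f :: "real \<Rightarrow> real"
  assumes "\<And>r. a \<le> r \<Longrightarrow> 0 \<le> f r"
  shows "0 \<le> (\<integral>r. f r \<partial>H)"
proof (rule integral_nonneg_AE)
  show "AE r in H. 0 \<le> f r" using AE_support by eventually_elim (use assms in auto)
qed

lemma df_integrand_bounds:
  assumes "0 \<le> v" "a \<le> r"
  shows "0 \<le> v * r / (1 + v * r)" and "v * r / (1 + v * r) < 1"
proof -
  have "0 \<le> v * r" using assms a_pos by simp
  then show "0 \<le> v * r / (1 + v * r)" "v * r / (1 + v * r) < 1" by auto
qed

lemma df_integrand_mono:
  fixes w v r s :: real
  assumes "0 \<le> w" "w \<le> v" "0 \<le> r" "r \<le> s"
  shows "w * r / (1 + w * r) \<le> v * s / (1 + v * s)"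
proof -
  have "w * r \<le> v * s" using assms by (intro mult_mono) auto
  moreover have "0 \<le> w * r" using assms by simp
  ultimately show ?thesis by (simp add: field_simps)
qed

lemma integrable_df: "0 \<le> v \<Longrightarrow> integrable H (\<lambda>r. v * r / (1 + v * r))"
  by (rule integrable_bounded_on_support[where K = 1], measurable)
     (use df_integrand_bounds[of v] in \<open>simp only: abs_of_nonneg order.strict_implies_order\<close>)

lemma eff_df_0 [simp]: "eff_df H 0 = 0"
  by (simp add: eff_df_def)

lemma eff_df_mono:
  assumes "0 \<le> w" "w \<le> v"
  shows "eff_df H w \<le> eff_df H v"
  unfolding eff_df_def
proof (rule integral_mono_AE)
  show "AE r in H. w * r / (1 + w * r) \<le> v * r / (1 + v * r)"
    using AE_support by eventually_elim (use assms a_pos df_integrand_mono in auto)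
qed (use assms integrable_df in auto)

lemma eff_df_diff_upper:
  assumes "0 \<le> w" "w \<le> v"
  shows "eff_df H v - eff_df H w \<le> (v - w) * b"
proof -
  have "eff_df H v \<le> (\<integral>r. w * r / (1 + w * r) + (v - w) * b \<partial>H)"
    unfolding eff_df_def
  proof (rule integral_mono_AE)
    show "AE r in H. v * r / (1 + v * r) \<le> w * r / (1 + w * r) + (v - w) * b"
      using AE_support
    proof eventually_elim
      case (elim r)
      have w: "0 \<le> w * r" and v: "0 \<le> v * r" and r: "0 \<le> r" using elim assms a_pos by auto
      have "1 * 1 \<le> (1 + v * r) * (1 + w * r)" using w v by (intro mult_mono) auto
      then have one_le: "1 \<le> (1 + v * r) * (1 + w * r)" by simp
      have "v * r / (1 + v * r) - w * r / (1 + w * r) = (v - w) * r / ((1 + v * r) * (1 + w * r))"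
        using w v by (simp add: divide_simps add_nonneg_eq_0_iff) (simp add: algebra_simps)
      also have "\<dots> \<le> (v - w) * r / 1"
        using one_le r assms by (intro divide_left_mono) auto
      also have "\<dots> \<le> (v - w) * b" using elim assms by (simp add: mult_left_mono)
      finally show ?case by simp
    qed
  qed (use assms integrable_df in auto)
  also have "\<dots> = eff_df H w + (v - w) * b"
    using assms integrable_df[of w] by (simp add: eff_df_def prob_space)
  finally show ?thesis by simp
qed

lemma eff_df_diff_lower:
  assumes "0 \<le> w" "w \<le> v"
  shows "(v - w) * (a / (1 + v * b)\<^sup>2) \<le> eff_df H v - eff_df H w"
proof -
  have "(\<integral>r. w * r / (1 + w * r) + (v - w) * (a / (1 + v * b)\<^sup>2) \<partial>H) \<le> eff_df H v"
    unfolding eff_df_def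
  proof (rule integral_mono_AE)
    show "AE r in H. w * r / (1 + w * r) + (v - w) * (a / (1 + v * b)\<^sup>2) \<le> v * r / (1 + v * r)"
      using AE_support
    proof eventually_elim
      case (elim r)
      have w: "0 \<le> w * r" and v: "0 \<le> v * r" and r: "0 \<le> r" using elim assms a_pos by auto
      have vb: "v * r \<le> v * b" and wb: "w * r \<le> v * b"
        using elim assms a_pos by (auto intro!: mult_mono)
      have "(1 + v * r) * (1 + w * r) \<le> (1 + v * b)\<^sup>2"
        unfolding power2_eq_square using w v vb wb by (intro mult_mono) auto
      then have "a / (1 + v * b)\<^sup>2 \<le> r / ((1 + v * r) * (1 + w * r))"
        using w v elim a_pos by (intro frac_le) (auto intro!: mult_pos_pos)
      then have "(v - w) * (a / (1 + v * b)\<^sup>2) \<le> (v - w) * (r / ((1 + v * r) * (1 + w * r)))"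
        using assms by (intro mult_left_mono) auto
      also have "\<dots> = v * r / (1 + v * r) - w * r / (1 + w * r)"
        using w v by (simp add: divide_simps add_nonneg_eq_0_iff) (simp add: algebra_simps)
      finally show ?case by simp
    qed
  qed (use assms integrable_df in auto)
  moreover have "(\<integral>r. w * r / (1 + w * r) + (v - w) * (a / (1 + v * b)\<^sup>2) \<partial>H)
      = eff_df H w + (v - w) * (a / (1 + v * b)\<^sup>2)"
    using assms integrable_df[of w] by (simp add: eff_df_def prob_space)
  ultimately show ?thesis by simp
qed

lemma continuous_on_eff_df: "continuous_on {0..} (eff_df H)"
proof (rule continuous_on_iff[THEN iffD2], intro ballI allI impI)
  fix v e :: real
  assume v: "v \<in> {0..}" and e: "0 < e"
  have b: "0 < b" using a_pos a_le_b by simp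
  have lip: "\<bar>eff_df H w - eff_df H v\<bar> \<le> \<bar>w - v\<bar> * b" if "0 \<le> w" for w
  proof (cases "v \<le> w")
    case True
    then show ?thesis using eff_df_diff_upper[of v w] eff_df_mono[of v w] v that by auto
  next
    case False
    then show ?thesis using eff_df_diff_upper[of w v] eff_df_mono[of w v] v that by auto
  qed
  show "\<exists>d>0. \<forall>w\<in>{0..}. dist w v < d \<longrightarrow> dist (eff_df H w) (eff_df H v) < e"
  proof (intro exI[of _ "e / b"] conjI ballI impI)
    fix w assume w: "w \<in> {0..}" "dist w v < e / b"
    then have "\<bar>w - v\<bar> * b < e" using b by (simp add: dist_real_def field_simps)
    then show "dist (eff_df H w) (eff_df H v) < e" using lip[of w] w by (simp add: dist_real_def)
  qed (use e b in simp)
qed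

lemma fixed_point_exists:
  assumes "0 \<le> l" "0 < \<theta>" "0 \<le> u" "1 \<le> l * u + \<theta> * eff_df H u"
  obtains v where "0 < v" "l * v + \<theta> * eff_df H v = 1"
proof -
  have "continuous_on {0..u} (\<lambda>v. l * v + \<theta> * eff_df H v)"
    by (intro continuous_intros continuous_on_subset[OF continuous_on_eff_df]) auto
  then obtain v where v: "0 \<le> v" "l * v + \<theta> * eff_df H v = 1"
    using IVT'[of "\<lambda>v. l * v + \<theta> * eff_df H v" 0 1 u] assms by auto
  then have "v \<noteq> 0" by auto
  with v(1) have "0 < v" by simp
  with v(2) that show ?thesis by blast
qed

lemma fixed_point_unique:
  assumes "0 < l" "0 < \<theta>" "0 \<le> v" "0 \<le> w"
    and "l * v + \<theta> * eff_df H v = 1" "l * w + \<theta> * eff_df H w = 1"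
  shows "v = w"
proof -
  have less: False
    if "0 \<le> x" "x < y" "l * x + \<theta> * eff_df H x = 1" "l * y + \<theta> * eff_df H y = 1" for x y
  proof -
    have "\<theta> * eff_df H x \<le> \<theta> * eff_df H y" using that assms eff_df_mono[of x y] by simp
    moreover have "l * x < l * y" using that assms by simp
    ultimately show False using that by linarith
  qed
  then show ?thesis using assms by (metis linorder_neqE)
qed

lemma v_ridge_equation_iff:
  assumes "0 < l" "0 < \<theta>" "0 \<le> v"
  shows "1 / v = l + \<theta> * (\<integral>r. r / (1 + v * r) \<partial>H) \<longleftrightarrow> l * v + \<theta> * eff_df H v = 1"
proof (cases "v = 0")
  case True
  have "0 \<le> (\<integral>r. r \<partial>H)"
    by (rule integral_nonneg_on_support) (use a_pos in auto)
  then have "0 < l + \<theta> * (\<integral>r. r \<partial>H)" using assms by (simp add: add_pos_nonneg)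
  with True show ?thesis by simp
next
  case False
  have "eff_df H v = v * (\<integral>r. r / (1 + v * r) \<partial>H)"
    by (simp add: eff_df_def flip: integral_mult_right_zero)
  with False show ?thesis by (auto simp: field_simps)
qed

lemma v_ridge_fixed_point:
  assumes "0 < l" "0 < \<theta>"
  shows "0 < v_ridge H l \<theta>" and "l * v_ridge H l \<theta> + \<theta> * eff_df H (v_ridge H l \<theta>) = 1"
proof -
  \<comment> \<open>at \<open>1 / l\<close> the linear term alone equals \<open>1\<close>\<close>
  have "0 \<le> eff_df H (1 / l)" using eff_df_mono[of 0 "1 / l"] assms by simp
  then obtain v where v: "0 < v" "l * v + \<theta> * eff_df H v = 1"
    using fixed_point_exists[of l \<theta> "1 / l"] assms by auto
  have "v_ridge H l \<theta> = v"
    unfolding v_ridge_def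
  proof (rule the_equality)
    show "v \<ge> 0 \<and> 1 / v = l + \<theta> * (\<integral>r. r / (1 + v * r) \<partial>H)"
      using v assms v_ridge_equation_iff by simp
    fix w assume "w \<ge> 0 \<and> 1 / w = l + \<theta> * (\<integral>r. r / (1 + w * r) \<partial>H)"
    then have "0 \<le> w" "l * w + \<theta> * eff_df H w = 1"
      using v_ridge_equation_iff[of l \<theta> w] assms by auto
    then show "w = v" using v assms fixed_point_unique[of l \<theta> w v] by simp
  qed
  with v show "0 < v_ridge H l \<theta>" "l * v_ridge H l \<theta> + \<theta> * eff_df H (v_ridge H l \<theta>) = 1" by auto
qed

text \<open>
  For \<open>\<theta> > 1\<close> the equation with \<open>l = 0\<close> has a root \<open>v\<^sub>0\<close>, since \<open>eff_df H\<close> tends to \<open>1\<close> at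
  infinity. The roots for \<open>k > 0\<close> converge to it: as \<open>eff_df H\<close> grows at least linearly on
  \<open>[0, v\<^sub>0]\<close>, the perturbation \<open>k v \<le> k v\<^sub>0\<close> of the equation moves the root by \<open>O(k)\<close>.
\<close>

lemma v_ridge_tendsto_ridgeless:
  assumes "1 < \<theta>"
  obtains v where "0 < v" "\<theta> * eff_df H v = 1" "((\<lambda>k. v_ridge H k \<theta>) \<longlongrightarrow> v) (at_right 0)"
proof -
  \<comment> \<open>\<open>u\<close> solves \<open>\<theta> u a / (1 + u a) = 1\<close>, the equation for the point mass at the lower end\<close>
  define u where "u = 1 / (a * (\<theta> - 1))"
  have u: "0 < u" using assms a_pos by (simp add: u_def)
  have "\<theta> * (u * a) = 1 + u * a" using assms a_pos by (simp add: u_def field_simps)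
  moreover have ua: "0 < u * a" using u a_pos by simp
  ultimately have u_eq: "u * a / (1 + u * a) = 1 / \<theta>" using assms by (simp add: field_simps)
  have "1 / \<theta> = (\<integral>r. u * a / (1 + u * a) \<partial>H)" by (simp add: u_eq prob_space)
  also have "\<dots> \<le> eff_df H u"
    unfolding eff_df_def
  proof (rule integral_mono_AE)
    show "AE r in H. u * a / (1 + u * a) \<le> u * r / (1 + u * r)"
      using AE_support by eventually_elim (use u a_pos df_integrand_mono in auto)
  qed (use u integrable_df in auto)
  finally have "1 \<le> \<theta> * eff_df H u" using assms by (simp add: field_simps)
  then obtain v where v: "0 < v" "\<theta> * eff_df H v = 1"
    using fixed_point_exists[of 0 \<theta> u] assms u by auto
  define C where "C = \<theta> * (a / (1 + v * b)\<^sup>2)"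
  have "0 < 1 + v * b" using v a_pos a_le_b by (simp add: add_pos_nonneg)
  then have C: "0 < C" using assms a_pos by (simp add: C_def)
  have bounds: "v - v * k / C \<le> v_ridge H k \<theta> \<and> v_ridge H k \<theta> \<le> v" if k: "0 < k" for k
  proof -
    define w where "w = v_ridge H k \<theta>"
    have w: "0 < w" "k * w + \<theta> * eff_df H w = 1"
      using v_ridge_fixed_point[of k \<theta>] k assms by (auto simp: w_def)
    have wv: "w \<le> v"
    proof (rule ccontr)
      assume "\<not> w \<le> v"
      then have "\<theta> * eff_df H v \<le> \<theta> * eff_df H w"
        using v assms eff_df_mono[of v w] by (intro mult_left_mono) auto
      moreover have "0 < k * w" using k w by simp
      ultimately show False using v w by linarith
    qed
    have "(v - w) * C = \<theta> * ((v - w) * (a / (1 + v * b)\<^sup>2))" by (simp add: C_def)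
    also have "\<dots> \<le> \<theta> * (eff_df H v - eff_df H w)"
      using eff_df_diff_lower[of w v] w wv assms by (intro mult_left_mono) auto
    also have "\<dots> = k * w" using v w by (simp add: algebra_simps)
    also have "\<dots> \<le> k * v" using k wv by simp
    finally have "v - w \<le> v * k / C" using C by (simp add: field_simps)
    with wv show ?thesis by (simp add: w_def)
  qed
  have ev: "\<forall>\<^sub>F k in at_right (0::real). 0 < k"
    by (simp add: eventually_at_right_less)
  have "((\<lambda>k. v - v * k / C) \<longlongrightarrow> v - v * 0 / C) (at_right 0)"
    by (intro tendsto_intros) (use C in auto)
  then have lower: "((\<lambda>k. v - v * k / C) \<longlongrightarrow> v) (at_right 0)" by simp
  have "((\<lambda>k. v_ridge H k \<theta>) \<longlongrightarrow> v) (at_right 0)"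
    by (rule tendsto_sandwich[OF _ _ lower tendsto_const])
       (use ev bounds in \<open>auto elim: eventually_mono\<close>)
  with v that show ?thesis by blast
qed

lemma v_fun_fixed_point:
  assumes "0 \<le> l" "0 < t" "0 < l \<or> 1 < t"
  obtains v where "v_fun H l (ereal t) = ereal v" "0 < v" "l * v + t * eff_df H v = 1"
proof (cases "0 < l")
  case True
  then show ?thesis using that[of "v_ridge H l t"] v_ridge_fixed_point[of l t] assms
    by (simp add: v_fun_def)
next
  case False
  with assms have l: "l = 0" and t: "1 < t" by auto
  obtain v where v: "0 < v" "t * eff_df H v = 1" "((\<lambda>k. v_ridge H k t) \<longlongrightarrow> v) (at_right 0)"
    using v_ridge_tendsto_ridgeless[OF t] by blast
  have "Lim (at_right 0) (\<lambda>k. v_ridge H k t) = v"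
    using v(3) by (intro tendsto_Lim) auto
  then show ?thesis using that[of v] v l t by (simp add: v_fun_def)
qed

text \<open>
  The integrand \<open>x = v r / (1 + v r)\<close> of \<open>eff_df\<close> is at most \<open>q = v b / (1 + v b) < 1\<close> on the
  support, so \<open>\<theta> v\<^sup>2 \<integral> r\<^sup>2 (1 + v r)\<^sup>-\<^sup>2 dH = \<theta> \<integral> x\<^sup>2 dH \<le> q \<theta> \<integral> x dH \<le> q < 1\<close>.
\<close>

lemma no_pole_at_fixed_point:
  assumes "0 \<le> l" "0 < \<theta>" "0 < v" "l * v + \<theta> * eff_df H v = 1"
  shows "\<theta> * (\<integral>r. r\<^sup>2 / (1 + v * r)\<^sup>2 \<partial>H) < 1 / v\<^sup>2"
proof -
  define q where "q = v * b / (1 + v * b)"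
  have q: "0 \<le> q" "q < 1" unfolding q_def using df_integrand_bounds[of v b] assms a_le_b by auto
  have sq: "v\<^sup>2 * (r\<^sup>2 / (1 + v * r)\<^sup>2) = (v * r / (1 + v * r))\<^sup>2" for r
    by (simp add: power_mult_distrib power_divide)
  have "v\<^sup>2 * (\<integral>r. r\<^sup>2 / (1 + v * r)\<^sup>2 \<partial>H) = (\<integral>r. (v * r / (1 + v * r))\<^sup>2 \<partial>H)"
    by (simp only: sq flip: integral_mult_right_zero)
  also have "\<dots> \<le> (\<integral>r. q * (v * r / (1 + v * r)) \<partial>H)"
  proof (rule integral_mono_AE)
    show "integrable H (\<lambda>r. (v * r / (1 + v * r))\<^sup>2)"
    proof (rule integrable_bounded_on_support[where K = 1])
      show "\<bar>(v * r / (1 + v * r))\<^sup>2\<bar> \<le> 1" if "a \<le> r" for r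
        using df_integrand_bounds[of v r] assms that power_le_one[of "v * r / (1 + v * r)" 2] by simp
    qed measurable
    show "integrable H (\<lambda>r. q * (v * r / (1 + v * r)))"
      using assms by (intro integrable_mult_right integrable_df) auto
    show "AE r in H. (v * r / (1 + v * r))\<^sup>2 \<le> q * (v * r / (1 + v * r))"
      using AE_support
    proof eventually_elim
      case (elim r)
      have "v * r / (1 + v * r) \<le> q"
        unfolding q_def using elim assms a_pos by (intro df_integrand_mono) auto
      then show ?case
        using df_integrand_bounds(1)[of v r] elim assms
        unfolding power2_eq_square by (intro mult_right_mono) auto
    qed
  qed
  also have "\<dots> = q * eff_df H v" unfolding eff_df_def by (rule integral_mult_right_zero)
  finally have "\<theta> * (v\<^sup>2 * (\<integral>r. r\<^sup>2 / (1 + v * r)\<^sup>2 \<partial>H)) \<le> \<theta> * (q * eff_df H v)"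
    using assms by (intro mult_left_mono) auto
  also have "\<dots> = q * (\<theta> * eff_df H v)" by simp
  also have "\<dots> \<le> q * 1"
  proof (rule mult_left_mono)
    have "0 \<le> l * v" using assms by simp
    then show "\<theta> * eff_df H v \<le> 1" using assms by linarith
  qed (use q in simp)
  also have "\<dots> < 1" using q by simp
  finally show ?thesis using assms by (simp add: field_simps)
qed

end

section \<open>Comparison at a fixed subsample aspect ratio\<close>

text \<open>
  \<open>\<psi> \<mapsto> \<psi> a / (d - \<psi> a)\<close> grows at least linearly, its numerator being linear while its
  denominator decreases.
\<close>

lemma variance_factor_scaling:
  fixes a d \<phi> \<theta> :: real
  assumes "0 \<le> a" "0 < \<phi>" "1 \<le> m" "real m * \<phi> \<le> \<theta>" "\<theta> * a < d"
  shows "\<phi> * a / (d - \<phi> * a) \<le> \<theta> * a / (d - \<theta> * a) / real m"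
proof -
  have "1 * \<phi> \<le> real m * \<phi>" using assms by (intro mult_right_mono) auto
  then have "\<phi> \<le> \<theta>" using assms by linarith
  then have "\<phi> * a \<le> \<theta> * a" using assms by (intro mult_right_mono) auto
  then have "\<phi> * a / (d - \<phi> * a) \<le> \<phi> * a / (d - \<theta> * a)"
    using assms by (intro divide_left_mono) auto
  also have "\<dots> \<le> (\<theta> / real m) * a / (d - \<theta> * a)"
    using assms by (intro divide_right_mono mult_right_mono) (auto simp: field_simps)
  also have "\<dots> = \<theta> * a / (d - \<theta> * a) / real m" by (simp add: field_simps)
  finally show ?thesis .
qed

lemma capped_bounds:
  assumes "0 < \<phi>" "1 \<le> M" "ereal \<phi> \<le> \<theta>"
  shows "1 \<le> capped M \<phi> \<theta>" and "\<theta> = ereal t \<Longrightarrow> real (capped M \<phi> \<theta>) * \<phi> \<le> t"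
proof -
  show "1 \<le> capped M \<phi> \<theta>"
  proof (cases \<theta>)
    case (real t)
    then have "1 \<le> t / \<phi>" using assms by simp
    then have "1 \<le> nat \<lfloor>t / \<phi>\<rfloor>" by linarith
    then show ?thesis using real assms by (simp add: capped_def)
  qed (use assms in \<open>auto simp: capped_def\<close>)
  assume t: "\<theta> = ereal t"
  then have "0 \<le> t / \<phi>" using assms by simp
  then have "real (nat \<lfloor>t / \<phi>\<rfloor>) \<le> t / \<phi>" by linarith
  then have "real (capped M \<phi> \<theta>) \<le> t / \<phi>" using t by (simp add: capped_def)
  then show "real (capped M \<phi> \<theta>) * \<phi> \<le> t" using assms by (simp add: field_simps)
qed

text \<open>
  As the number of bags grows, only the off-diagonal term of the subagged risk survives. The
  infimum is below this limit even if no finite number of bags attains it.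
\<close>

lemma INF_risk_sub_le_limit:
  assumes "V_lim H \<sigma> l \<theta> \<theta> = ereal x" and "V_lim H \<sigma> l (ereal \<phi>) \<theta> = ereal y"
  shows "(INF M\<in>{1::nat..}. risk_sub H G \<rho> \<sigma> l M \<phi> \<theta>)
       \<le> ereal (\<sigma>\<^sup>2 + (B_lim H G \<rho> l (ereal \<phi>) \<theta> + y))"
proof -
  define X Y where "X = B_lim H G \<rho> l \<theta> \<theta> + x" and "Y = B_lim H G \<rho> l (ereal \<phi>) \<theta> + y"
  have risk: "risk_sub H G \<rho> \<sigma> l M \<phi> \<theta> = ereal (\<sigma>\<^sup>2 + 1 / real M * X + (1 - 1 / real M) * Y)" for M
    by (simp add: risk_sub_def assms X_def Y_def)
  have "(\<lambda>M. \<sigma>\<^sup>2 + 1 / real M * X + (1 - 1 / real M) * Y) \<longlonglongrightarrow> \<sigma>\<^sup>2 + 0 * X + (1 - 0) * Y"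
    by (intro tendsto_intros lim_1_over_n)
  then have "(\<lambda>M. risk_sub H G \<rho> \<sigma> l M \<phi> \<theta>) \<longlonglongrightarrow> ereal (\<sigma>\<^sup>2 + Y)"
    unfolding risk by simp
  then show ?thesis
    unfolding Y_def by (rule LIMSEQ_le_const) (auto intro!: exI[of _ 1] INF_lower)
qed

text \<open>
  The common shape of all finite cases: \<open>c\<close> is the bias of a single bag without its variance
  inflation, \<open>k\<close> and \<open>k'\<close> are the variance factors at \<open>\<theta>\<close> and at \<open>\<phi>\<close>.
\<close>

lemma INF_risk_sub_le_risk_spl_of_factors:
  assumes V: "V_lim H \<sigma> l \<theta> \<theta> = ereal (\<sigma>\<^sup>2 * k)" "V_lim H \<sigma> l (ereal \<phi>) \<theta> = ereal (\<sigma>\<^sup>2 * k')"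
    and B: "B_lim H G \<rho> l \<theta> \<theta> = c * (1 + k)" "B_lim H G \<rho> l (ereal \<phi>) \<theta> = c * (1 + k')"
    and C: "C_lim H G \<rho> l \<theta> = c" and c: "0 \<le> c"
    and m: "1 \<le> capped M \<phi> \<theta>" and k: "k' \<le> k / real (capped M \<phi> \<theta>)"
  shows "(INF M\<in>{1::nat..}. risk_sub H G \<rho> \<sigma> l M \<phi> \<theta>) \<le> risk_spl H G \<rho> \<sigma> l M \<phi> \<theta>"
proof -
  define m where "m = capped M \<phi> \<theta>"
  have m_pos: "0 < real m" using m by (simp add: m_def)
  have "(c + \<sigma>\<^sup>2) * k' \<le> (c + \<sigma>\<^sup>2) * (k / real m)"
    using k c by (intro mult_left_mono) (auto simp: m_def)
  then have "\<sigma>\<^sup>2 + (c * (1 + k') + \<sigma>\<^sup>2 * k')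
      \<le> \<sigma>\<^sup>2 + 1 / real m * (c * (1 + k) + \<sigma>\<^sup>2 * k) + (1 - 1 / real m) * c"
    using m_pos by (simp add: algebra_simps)
  moreover have "risk_spl H G \<rho> \<sigma> l M \<phi> \<theta>
      = ereal (\<sigma>\<^sup>2 + 1 / real m * (c * (1 + k) + \<sigma>\<^sup>2 * k) + (1 - 1 / real m) * c)"
    by (simp add: risk_spl_def Let_def V B C m_def)
  ultimately show ?thesis
    using INF_risk_sub_le_limit[OF V, of G \<rho>] unfolding B(2) by (simp add: order_trans)
qed

lemma INF_risk_sub_le_risk_spl:
  assumes H: "compact_spectrum H a b" and G: "compact_spectrum G a b"
    and l: "0 \<le> l" and \<phi>: "0 < \<phi>" and M: "1 \<le> M" and \<theta>: "ereal \<phi> \<le> \<theta>"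
  shows "(INF M\<in>{1::nat..}. risk_sub H G \<rho> \<sigma> l M \<phi> \<theta>) \<le> risk_spl H G \<rho> \<sigma> l M \<phi> \<theta>"
proof -
  interpret H: compact_spectrum H a b by fact
  interpret G: compact_spectrum G a b by fact
  note m = capped_bounds[OF \<phi> M \<theta>]
  have c_tilde_nonneg: "0 \<le> c_tilde H G l \<theta>"
    if "real_of_ereal (v_fun H l \<theta>) = v" "0 \<le> v" for v
    unfolding c_tilde_def Let_def that(1)
    by (rule G.integral_nonneg_on_support) (use that G.a_pos in auto)
  consider (infinite) "\<theta> = \<infinity>"
    | (regular) t where "\<theta> = ereal t" "0 < l \<or> 1 < t"
    | (under) t where "\<theta> = ereal t" "l = 0" "t < 1"
    | (threshold) "\<theta> = 1" "l = 0"
  proof (cases \<theta>)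
    case (real t)
    show ?thesis
    proof (cases "0 < l \<or> 1 < t")
      case True
      with real show ?thesis by (rule regular)
    next
      case False
      then have "l = 0" "t = 1 \<or> t < 1" using l by auto
      then show ?thesis using real under threshold by auto
    qed
  qed (use infinite \<theta> in auto)
  then show ?thesis
  proof cases
    case infinite
    have "0 \<le> c_tilde H G l \<theta>" using infinite by (intro c_tilde_nonneg[of 0]) (auto simp: v_fun_def)
    then show ?thesis using infinite m
      by (intro INF_risk_sub_le_risk_spl_of_factors[where c = "\<rho>\<^sup>2 * c_tilde H G l \<theta>" and k = 0 and k' = 0])
         (auto simp: V_lim_def B_lim_def C_lim_def v_tilde_def)
  next
    case (regular t)
    have t: "0 < t" using \<theta> \<phi> regular by simp
    then obtain v where v: "v_fun H l \<theta> = ereal v" "0 < v" "l * v + t * eff_df H v = 1"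
      using H.v_fun_fixed_point[of l t] l regular by auto
    define A where "A = (\<integral>r. r\<^sup>2 / (1 + v * r)\<^sup>2 \<partial>H)"
    have A: "0 \<le> A" unfolding A_def by (intro H.integral_nonneg_on_support) auto
    have pole: "t * A < 1 / v\<^sup>2" unfolding A_def using H.no_pole_at_fixed_point l t v by blast
    have vt: "v_tilde H l (ereal \<psi>) \<theta> = \<psi> * A / (1 / v\<^sup>2 - \<psi> * A)" for \<psi>
      using regular v by (simp add: v_tilde_def A_def Let_def)
    have "0 \<le> c_tilde H G l \<theta>" using v by (intro c_tilde_nonneg[of v]) auto
    then have c: "0 \<le> \<rho>\<^sup>2 * c_tilde H G l \<theta>" by simp
    have "v_tilde H l (ereal \<phi>) \<theta> \<le> v_tilde H l \<theta> \<theta> / real (capped M \<phi> \<theta>)"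
      using variance_factor_scaling[OF A \<phi> m(1) m(2)[OF regular(1)] pole] vt[of t] vt[of \<phi>]
      by (simp only: regular(1))
    moreover have "\<not> (l = 0 \<and> \<theta> \<le> 1)" "\<not> (l = 0 \<and> \<theta> < 1)" "\<not> (l = 0 \<and> \<theta> = 1)"
      using regular by auto
    ultimately show ?thesis using c m(1)
      by (intro INF_risk_sub_le_risk_spl_of_factors[where c = "\<rho>\<^sup>2 * c_tilde H G l \<theta>"
            and k = "v_tilde H l \<theta> \<theta>" and k' = "v_tilde H l (ereal \<phi>) \<theta>"])
         (simp_all only: V_lim_def B_lim_def C_lim_def if_False mult.assoc mult.commute mult.left_commute)
  next
    case (under t)
    \<comment> \<open>the variance factor \<open>\<psi> / (1 - \<psi>)\<close> has the regular shape with \<open>a = d = 1\<close>\<close>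
    have "\<phi> / (1 - \<phi>) \<le> t / (1 - t) / real (capped M \<phi> \<theta>)"
      using variance_factor_scaling[of 1 \<phi> "capped M \<phi> \<theta>" t 1] under m \<phi> by simp
    moreover have "\<theta> < 1" "\<theta> \<le> 1" using under by auto
    ultimately show ?thesis using under(1,2) m(1)
      by (intro INF_risk_sub_le_risk_spl_of_factors[where c = 0 and k = "t / (1 - t)"
            and k' = "\<phi> / (1 - \<phi>)"])
         (simp_all add: V_lim_def B_lim_def C_lim_def)
  next
    case threshold
    show ?thesis
    proof (cases "\<sigma>\<^sup>2 = 0")
      case True
      then show ?thesis using threshold m
        by (intro INF_risk_sub_le_risk_spl_of_factors[where c = 0 and k = 0 and k' = 0])
           (auto simp: V_lim_def B_lim_def C_lim_def zero_ereal_def)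
    next
      case False
      \<comment> \<open>the single-bag variance is infinite and carries the positive weight \<open>1 / m\<close>\<close>
      then have "risk_spl H G \<rho> \<sigma> l M \<phi> \<theta> = \<infinity>" using threshold m
        by (simp add: risk_spl_def Let_def V_lim_def B_lim_def C_lim_def)
      then show ?thesis by simp
    qed
  qed
qed

theorem proposition4p6:
  fixes H G :: "real measure" and r_min r_max \<rho> \<sigma> l \<phi> :: real
  assumes "0 < r_min" and "r_min \<le> r_max"
    and "supported_on H {r_min..r_max}"
    and "supported_on G {r_min..r_max}"
    and "0 \<le> l" and "0 < \<phi>"
  shows "(INF (M, \<phi>\<^sub>s) \<in> {1::nat..} \<times> {ereal \<phi>..\<infinity>}. risk_sub H G \<rho> \<sigma> l M \<phi> \<phi>\<^sub>s)
       \<le> (INF (M, \<phi>\<^sub>s) \<in> {1::nat..} \<times> {ereal \<phi>..\<infinity>}. risk_spl H G \<rho> \<sigma> l M \<phi> \<phi>\<^sub>s)"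
proof (rule INF_greatest)
  fix p :: "nat \<times> ereal"
  assume "p \<in> {1..} \<times> {ereal \<phi>..\<infinity>}"
  then obtain M \<theta> where p: "p = (M, \<theta>)" and M: "M \<in> {1..}" and \<theta>: "\<theta> \<in> {ereal \<phi>..\<infinity>}" by blast
  have "(INF (M, \<theta>) \<in> {1::nat..} \<times> {ereal \<phi>..\<infinity>}. risk_sub H G \<rho> \<sigma> l M \<phi> \<theta>)
      \<le> (INF M\<in>{1::nat..}. risk_sub H G \<rho> \<sigma> l M \<phi> \<theta>)"
    using \<theta> by (intro INF_greatest INF_lower2) auto
  also have "\<dots> \<le> risk_spl H G \<rho> \<sigma> l M \<phi> \<theta>"
    using INF_risk_sub_le_risk_spl[of H r_min r_max G] assms M \<theta>
    by (simp add: compact_spectrum_def)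
  finally show "(INF (M, \<theta>) \<in> {1::nat..} \<times> {ereal \<phi>..\<infinity>}. risk_sub H G \<rho> \<sigma> l M \<phi> \<theta>)
      \<le> (case p of (M, \<theta>) \<Rightarrow> risk_spl H G \<rho> \<sigma> l M \<phi> \<theta>)"
    by (simp add: p)
qed

end
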